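(* Let $\mathcal T$ be the digraph obtained from the rooted tree in which every vertex has exactly countably infinitely many children by letting $B_0$ be the set consisting of the root and the vertices on every other level (i.e. all vertices at even distance from the root) and directing all edges towards $B_0$. Then every dimaze $(D',B_0')$ such that $M_L(D',B_0')$ is a matroid isomorphic to $M_L(\mathcal T,B_0)$ contains an alternating comb.
   Context: Matroids (possibly infinite, in the sense of Bruhn et al.): for a set $E$ and $\mathcal I\subseteq 2^E$, let $\mathcal I^{\max}$ be the set of inclusion-maximal elements of $\mathcal I$. The pair $(E,\mathcal I)$ is a matroid if: (I1) $\emptyset\in\mathcal I$; (I2) if $I\subseteq I'$ and $I'\in\mathcal I$ then $I\in\mathcal I$; (I3) for all $I\in\mathcal I\setminus\mathcal I^{\max}$ and $I'\in\mathcal I^{\max}$ there is $x\in I'\setminus I$ with $I\cup\{x\}\in\mathcal I$; (IM) whenever $I\in\mathcal I$ and $I\subseteq X\subseteq E$, the set $\{I'\in\mathcal I: I\subseteq I'\subseteq X\}$ has a maximal element. Two matroids are isomorphic if there is a bijection between their ground sets that maps independent sets onto independent sets in both directions. Dimazes: a dimaze is a pair $(D,B_0)$ where $D$ is a digraph (of arbitrary cardinality) and $B_0$ is a subset of the set of vertices of $D$ of out-degree $0$; the elements of $B_0$ are called exits. A linkage is a set $\mathcal P$ of pairwise (vertex-)disjoint finite directed paths (possibly trivial, i.e. consisting of a single vertex) in $D$, each of whose terminal vertices lies in $B_0$. A set $I\subseteq V(D)$ is linkable (or independent) if there is a linkage $\mathcal P$ such that the set of initial vertices of paths in $\mathcal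 P$ is exactly $I$. $M_L(D,B_0)$ denotes the pair consisting of $V(D)$ and the family of all linkable subsets of $V(D)$. A matroid of the form $M_L(D,B_0)$ is called a strict gammoid. (The pair $M_L(\mathcal T,B_0)$ in the claim is known to be a matroid.) Alternating combs: an alternating ray is a digraph whose underlying graph is a ray (a one-way infinite path) and which has infinitely many vertices of in-degree $2$. An alternating comb is a dimaze constructed from an alternating ray by linking all its vertices of in-degree $2$ together with its first vertex onto a set of exits by (possibly trivial) pairwise disjoint directed paths which meet the ray exactly at their initial vertices. A dimaze $(D,B_0)$ contains an alternating comb if $D$ contains the digraph of some alternating comb as a subdigraph and $B_0$ contains the exits of that alternating comb. *)

theory Defs
  imports "Graph_Theory.Graph_Theory"
begin

section \<open>Matroids on arbitrary ground sets\<close>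

type_synonym 'a set_system = "'a set \<times> 'a set set"

definition max_sets :: "'a set set \<Rightarrow> 'a set set" where
  "max_sets \<I> = {M \<in> \<I>. \<forall>X\<in>\<I>. M \<subseteq> X \<longrightarrow> X = M}"

definition matroid :: "'a set_system \<Rightarrow> bool" where
  "matroid M \<longleftrightarrow> (case M of (E, \<I>) \<Rightarrow>
     \<I> \<subseteq> Pow E \<and>
     {} \<in> \<I> \<and>
     (\<forall>I I'. I \<subseteq> I' \<and> I' \<in> \<I> \<longrightarrow> I \<in> \<I>) \<and>
     (\<forall>I \<in> \<I> - max_sets \<I>. \<forall>I' \<in> max_sets \<I>. \<exists>x \<in> I' - I. I \<union> {x} \<in> \<I>) \<and>
     (\<forall>I X. I \<in> \<I> \<and> I \<subseteq> X \<and> X \<subseteq> E \<longrightarrow>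
        max_sets {I' \<in> \<I>. I \<subseteq> I' \<and> I' \<subseteq> X} \<noteq> {}))"

definition set_system_iso :: "'a set_system \<Rightarrow> 'b set_system \<Rightarrow> bool" where
  "set_system_iso M N \<longleftrightarrow> (case M of (E, \<I>) \<Rightarrow> case N of (F, \<J>) \<Rightarrow>
     \<exists>f. bij_betw f E F \<and> (\<forall>I. I \<subseteq> E \<longrightarrow> (I \<in> \<I> \<longleftrightarrow> f ` I \<in> \<J>)))"


section \<open>Dimazes and linkability\<close>

text \<open>
  Out-degree zero is expressed by \<^const>\<open>out_arcs\<close> being empty, because
  \<^const>\<open>out_degree\<close> is also 0 at vertices with infinitely many outgoing arcs.
\<close>

definition dimaze :: "('v, 'e) pre_digraph \<Rightarrow> 'v set \<Rightarrow> bool" where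
  "dimaze D B \<longleftrightarrow> wf_digraph D \<and> B \<subseteq> {v \<in> verts D. out_arcs D v = {}}"

text \<open>
  A finite directed path is given by its nonempty list of vertices, its initial vertex
  being \<^const>\<open>hd\<close> and its terminal vertex \<^const>\<open>last\<close>.
\<close>

definition linkage :: "('v, 'e) pre_digraph \<Rightarrow> 'v set \<Rightarrow> 'v list set \<Rightarrow> bool" where
  "linkage D B P \<longleftrightarrow>
     (\<forall>p\<in>P. vpath p D \<and> last p \<in> B) \<and>
     pairwise (\<lambda>p q. disjnt (set p) (set q)) P"

definition linkable :: "('v, 'e) pre_digraph \<Rightarrow> 'v set \<Rightarrow> 'v set \<Rightarrow> bool" where
  "linkable D B I \<longleftrightarrow> (\<exists>P. linkage D B P \<and> hd ` P = I)"

definition M_L :: "('v, 'e) pre_digraph \<Rightarrow> 'v set \<Rightarrow> 'v set_system" where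
  "M_L D B = (verts D, {I. I \<subseteq> verts D \<and> linkable D B I})"


section \<open>Alternating combs\<close>

text \<open>
  The map \<open>a\<close> enumerates the arcs, exactly one (in either direction) for each edge of the
  underlying ray \<open>r 0, r 1, \<dots>\<close>.
\<close>

definition underlying_ray :: "('v, 'e) pre_digraph \<Rightarrow> (nat \<Rightarrow> 'v) \<Rightarrow> bool" where
  "underlying_ray R r \<longleftrightarrow>
     inj r \<and> verts R = range r \<and>
     (\<exists>a :: nat \<Rightarrow> 'e. bij_betw a UNIV (arcs R) \<and>
        (\<forall>n. {tail R (a n), head R (a n)} = {r n, r (Suc n)}))"

definition alternating_ray :: "('v, 'e) pre_digraph \<Rightarrow> (nat \<Rightarrow> 'v) \<Rightarrow> bool" where
  "alternating_ray R r \<longleftrightarrow>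
     wf_digraph R \<and> underlying_ray R r \<and> infinite {v \<in> verts R. in_degree R v = 2}"

text \<open>
  The last two conjuncts say that the digraph of the comb is precisely the union of the ray
  and the linking paths. That a comb is a dimaze rules out a trivial path at the first
  vertex \<open>r 0\<close> of the ray when the ray's arc at \<open>r 0\<close> leaves \<open>r 0\<close>.
\<close>

definition alternating_comb :: "('v, 'e) pre_digraph \<Rightarrow> 'v set \<Rightarrow> bool" where
  "alternating_comb C X \<longleftrightarrow>
     dimaze C X \<and> nomulti_digraph C \<and>
     (\<exists>R r P. alternating_ray R r \<and> subgraph R C \<and>
        linkage C X P \<and>
        hd ` P = insert (r 0) {v \<in> verts R. in_degree R v = 2} \<and>
        last ` P = X \<and>
        (\<forall>p\<in>P. set p \<inter> verts R = {hd p}) \<and>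
        verts C = verts R \<union> (\<Union>p\<in>P. set p) \<and>
        arcs_ends C = arcs_ends R \<union> (\<Union>p\<in>P. set (vwalk_arcs p)))"

definition contains_alternating_comb :: "('v, 'e) pre_digraph \<Rightarrow> 'v set \<Rightarrow> bool" where
  "contains_alternating_comb D B \<longleftrightarrow>
     (\<exists>C X. alternating_comb C X \<and> subgraph C D \<and> X \<subseteq> B)"


section \<open>The directed tree\<close>

text \<open>
  Vertices of the rooted tree are the finite sequences of naturals: the root is \<open>[]\<close>, the
  children of \<open>v\<close> are the sequences \<open>n # v\<close>, and the distance of \<open>v\<close> from the root is
  \<^term>\<open>length v\<close>.
\<close>

definition omega_tree_exits :: "nat list set" where
  "omega_tree_exits = {v. even (length v)}"

definition omega_tree :: "(nat list, nat list \<times> nat list) pre_digraph" where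
  "omega_tree = \<lparr> verts = UNIV,
            arcs = {(n # v, v) | n v. v \<in> omega_tree_exits} \<union>
                   {(v, n # v) | n v. n # v \<in> omega_tree_exits},
            tail = fst, head = snd \<rparr>"

lemma dimaze_omega_tree: "dimaze omega_tree omega_tree_exits"
  by (auto simp: dimaze_def omega_tree_def omega_tree_exits_def out_arcs_def wf_digraph_def)

end

theory Submission
  imports Defs
begin

text \<open>
  In the tree matroid every finite set is independent, and every finite set is avoided by some
  maximal independent set; these two properties are invariant under isomorphism and already
  force an alternating comb. Independence of finite sets gives, by counting disjoint paths,
  that an exit \<open>y\<close> reached by infinitely many vertices off a finite set is reached by
  a path \<open>q\<close> whose first vertex still reaches infinitely many exits off that
  set and the rest of \<open>q\<close>. Avoidability gives, by the same counting, that all but finitely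
  many exits are reached by infinitely many vertices off a given finite set. So, from the
  current last vertex \<open>v\<close> of the ray, which reaches infinitely many exits off the finite set
  used so far, take a path \<open>p\<close> to such an exit \<open>y\<close>, then a path \<open>q\<close> from a new vertex
  \<open>v'\<close> to \<open>y\<close>, and stop \<open>q\<close> at the first vertex \<open>w\<close> where it meets \<open>p\<close>. The ray is
  continued along \<open>p\<close> to \<open>w\<close> and then backwards along \<open>q\<close> to \<open>v'\<close>, while the rest of
  \<open>p\<close> links \<open>w\<close> to the exit \<open>y\<close>.
\<close>

section \<open>Paths and linkages\<close>

lemma vpath_appendD1: "vpath (xs @ ys) D \<Longrightarrow> xs \<noteq> [] \<Longrightarrow> vpath xs D"
  using set_vwalk_arcs_append1[of xs ys] by (auto simp: vpath_def vwalk_def)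

lemma vpath_appendD2: "vpath (xs @ ys) D \<Longrightarrow> ys \<noteq> [] \<Longrightarrow> vpath ys D"
  using set_vwalk_arcs_append2[of ys xs] by (auto simp: vpath_def vwalk_def)

lemma vpath_not_Nil: "vpath p D \<Longrightarrow> p \<noteq> []"
  by (auto simp: vpath_def vwalk_def)

lemma vpath_subset_verts: "vpath p D \<Longrightarrow> set p \<subseteq> verts D"
  by (auto simp: vpath_def vwalk_def)

lemma vpath_arcs_subset: "vpath p D \<Longrightarrow> set (vwalk_arcs p) \<subseteq> arcs_ends D"
  by (auto simp: vpath_def vwalk_def)

lemma vpath_singleton: "x \<in> verts D \<Longrightarrow> vpath [x] D"
  by (auto simp: vpath_def vwalk_def)

lemma exit_no_arc: "dimaze D B \<Longrightarrow> x \<in> B \<Longrightarrow> (x, y) \<notin> arcs_ends D"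
  by (auto simp: dimaze_def arcs_ends_def arc_to_ends_def out_arcs_def)

text \<open>No arc leaves an exit, so a path cannot continue after one.\<close>

lemma vpath_exit_last:
  assumes "dimaze D B" "vpath p D" "x \<in> set p" "x \<in> B"
  shows "x = last p"
proof -
  obtain xs ys where p: "p = xs @ x # ys"
    using assms(3) by (meson split_list)
  then have "vpath (x # ys) D"
    using assms(2) vpath_appendD2 by blast
  then have "ys = []"
    using exit_no_arc[OF assms(1,4)] vpath_arcs_subset by (cases ys) fastforce+
  then show ?thesis
    by (simp add: p)
qed

lemma linkage_eqI:
  assumes "linkage D B P" "p \<in> P" "q \<in> P" "x \<in> set p" "x \<in> set q"
  shows "p = q"
  using assms by (fastforce simp: linkage_def pairwise_def disjnt_iff)

lemma linkage_not_Nil: "linkage D B P \<Longrightarrow> p \<in> P \<Longrightarrow> p \<noteq> []"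
  using vpath_not_Nil by (auto simp: linkage_def)

text \<open>Pigeonhole: the paths are disjoint, so each vertex of \<open>G\<close> spoils at most
  one of them. The map \<open>f\<close> is left open because initial vertices (\<open>hd\<close>)
  and terminal vertices (\<open>last\<close>) are both counted later.\<close>

lemma linkage_avoids:
  assumes P: "linkage D B P" and T: "T \<subseteq> f ` P" and G: "finite G" "card G < card T"
  shows "\<exists>p\<in>P. f p \<in> T \<and> set p \<inter> G = {}"
proof (rule ccontr)
  assume neg: "\<not> ?thesis"
  have "\<forall>t\<in>T. \<exists>p g. p \<in> P \<and> f p = t \<and> g \<in> set p \<inter> G"
    using neg T by (fastforce simp: image_iff)
  then obtain p g where pg: "\<And>t. t \<in> T \<Longrightarrow> p t \<in> P \<and> f (p t) = t \<and> g t \<in> set (p t) \<inter> G"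
    by metis
  have "inj_on g T"
    by (rule inj_onI) (metis IntD1 P linkage_eqI pg)
  moreover have "g ` T \<subseteq> G"
    using pg by auto
  ultimately show False
    using card_inj_on_le[of g T G] G by simp
qed

text \<open>Both ends must avoid \<open>F\<close> too; hence the start is taken out of the forbidden
  sets below, as in \<open>set q - {hd q}\<close>.\<close>

definition reaches :: "('v, 'e) pre_digraph \<Rightarrow> 'v set \<Rightarrow> 'v \<Rightarrow> 'v \<Rightarrow> bool" where
  "reaches D F x y \<longleftrightarrow> (\<exists>p. vpath p D \<and> hd p = x \<and> last p = y \<and> set p \<inter> F = {})"

lemma reaches_antimono: "reaches D F x y \<Longrightarrow> F' \<subseteq> F \<Longrightarrow> reaches D F' x y"
  unfolding reaches_def by blast

lemma reaches_verts: "reaches D F x y \<Longrightarrow> x \<in> verts D"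
  unfolding reaches_def using vpath_subset_verts vpath_not_Nil hd_in_set by (metis subsetD)

section \<open>Finite vertex sets in the tree matroid\<close>

text \<open>For a matroid this means that no circuit is finite, and
  \<open>all_finite_avoidable\<close> that no cocircuit is finite.\<close>

definition all_finite_independent :: "'a set_system \<Rightarrow> bool" where
  "all_finite_independent M \<longleftrightarrow> (\<forall>I. finite I \<and> I \<subseteq> fst M \<longrightarrow> I \<in> snd M)"

definition all_finite_avoidable :: "'a set_system \<Rightarrow> bool" where
  "all_finite_avoidable M \<longleftrightarrow>
     (\<forall>F. finite F \<and> F \<subseteq> fst M \<longrightarrow> (\<exists>J\<in>max_sets (snd M). J \<subseteq> fst M \<and> J \<inter> F = {}))"

lemma set_system_iso_transfer:
  assumes iso: "set_system_iso M N"
    and M: "snd M \<subseteq> Pow (fst M)"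
    and ind: "all_finite_independent N" and av: "all_finite_avoidable N"
  shows "all_finite_independent M" "all_finite_avoidable M"
proof -
  obtain f where f: "bij_betw f (fst M) (fst N)"
    and fI: "\<And>I. I \<subseteq> fst M \<Longrightarrow> I \<in> snd M \<longleftrightarrow> f ` I \<in> snd N"
    using iso by (auto simp: set_system_iso_def split: prod.splits)
  have img: "f ` I \<subseteq> fst N" if "I \<subseteq> fst M" for I
    using f that by (auto simp: bij_betw_def)
  show "all_finite_independent M"
    using ind img fI by (auto simp: all_finite_independent_def)
  show "all_finite_avoidable M"
    unfolding all_finite_avoidable_def
  proof (intro allI impI)
    fix F assume F: "finite F \<and> F \<subseteq> fst M"
    have "finite (f ` F)" "f ` F \<subseteq> fst N"
      using F img by auto
    then obtain J where J: "J \<in> max_sets (snd N)" "J \<subseteq> fst N" "J \<inter> f ` F = {}"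
      using av unfolding all_finite_avoidable_def by meson
    \<comment> \<open>The preimage of \<open>J\<close> is cut down to the ground set because
      \<open>f\<close> is arbitrary outside it.\<close>
    define K where "K = fst M \<inter> f -` J"
    have KM: "K \<subseteq> fst M"
      by (auto simp: K_def)
    have fK: "f ` K = J"
    proof (intro equalityI subsetI)
      fix x assume x: "x \<in> J"
      then have "x \<in> f ` fst M"
        using J(2) f by (auto simp: bij_betw_def)
      then obtain a where "a \<in> fst M" "x = f a"
        by (metis imageE)
      then show "x \<in> f ` K"
        using x by (auto simp: K_def)
    qed (auto simp: K_def)
    have "K \<in> max_sets (snd M)"
      unfolding max_sets_def
    proof (safe)
      show "K \<in> snd M"
        using fI[OF KM] fK J(1) by (simp add: max_sets_def)
    next
      fix X x assume X: "X \<in> snd M" "K \<subseteq> X" and x: "x \<in> X"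
      have XM: "X \<subseteq> fst M"
        using X M by auto
      have "f ` X \<in> snd N" "J \<subseteq> f ` X"
        using X fI[OF XM] fK by auto
      then have "f ` X = J"
        using J(1) by (auto simp: max_sets_def)
      then show "x \<in> K"
        using x XM by (auto simp: K_def)
    qed
    moreover have "K \<inter> F = {}"
      using J(3) by (auto simp: K_def)
    ultimately show "\<exists>J\<in>max_sets (snd M). J \<subseteq> fst M \<and> J \<inter> F = {}"
      using KM by auto
  qed
qed

section \<open>The two properties for the tree\<close>

lemma omega_tree_arc_down: "odd (length v) \<Longrightarrow> (v, n # v) \<in> arcs_ends omega_tree"
  by (auto simp: arcs_ends_def arc_to_ends_def omega_tree_def omega_tree_exits_def)

lemma omega_tree_arc_up: "even (length v) \<Longrightarrow> (n # v, v) \<in> arcs_ends omega_tree"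
  by (auto simp: arcs_ends_def arc_to_ends_def omega_tree_def omega_tree_exits_def)

lemma verts_omega_tree [simp]: "verts omega_tree = UNIV"
  by (simp add: omega_tree_def)

lemma fresh_child:
  fixes F :: "nat list set"
  assumes "finite F"
  obtains k where "\<And>v. k # v \<notin> F"
proof -
  \<comment> \<open>Avoiding all first entries makes one \<open>k\<close> serve every
    \<open>v\<close>; the list \<open>[]\<close> only rules out the unspecified value
    \<open>hd []\<close> in addition.\<close>
  obtain k where "k \<notin> hd ` F"
    using assms ex_new_if_finite infinite_UNIV_nat by (metis finite_imageI)
  then have "k # v \<notin> F" for v
    by force
  then show thesis
    using that by blast
qed

text \<open>Even levels consist of exits, which are linked trivially. A vertex \<open>v\<close> on
  an odd level is linked to its child \<open>k # v\<close>, which lies outside \<open>I\<close>, so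
  the paths are disjoint.\<close>

lemma omega_tree_all_finite_independent:
  "all_finite_independent (M_L omega_tree omega_tree_exits)"
proof -
  have "linkable omega_tree omega_tree_exits I" if "finite I" for I
  proof -
    obtain k where k: "\<And>v. k # v \<notin> I"
      using fresh_child[OF \<open>finite I\<close>] by metis
    define g where "g v = (if even (length v) then [v] else [v, k # v])" for v :: "nat list"
    have "linkage omega_tree omega_tree_exits (g ` I)"
      using k by (auto simp: linkage_def g_def vpath_def vwalk_def pairwise_def disjnt_iff
          omega_tree_arc_down omega_tree_exits_def)
    moreover have "hd ` g ` I = I"
    proof -
      have "hd (g v) = v" for v
        by (simp add: g_def)
      then show ?thesis
        by (simp add: image_image)
    qed
    ultimately show ?thesis
      unfolding linkable_def by blast
  qed
  then show ?thesis
    by (simp add: all_finite_independent_def M_L_def)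
qed

text \<open>Start from the set of all exits and replace each exit in \<open>F\<close> by a child
  outside \<open>F\<close>; the arc from this child to the exit keeps the set linkable.\<close>

lemma omega_tree_all_finite_avoidable:
  "all_finite_avoidable (M_L omega_tree omega_tree_exits)"
  unfolding all_finite_avoidable_def
proof (intro allI impI)
  let ?B = omega_tree_exits and ?M = "M_L omega_tree omega_tree_exits"
  fix F assume "finite F \<and> F \<subseteq> fst ?M"
  then have F: "finite F"
    by simp
  obtain k where k: "\<And>v. k # v \<notin> F"
    using fresh_child[OF F] by metis
  define J where "J = (?B - F) \<union> (\<lambda>u. k # u) ` (F \<inter> ?B)"
  have "linkable omega_tree ?B J"
  proof -
    define P where "P = (\<lambda>u. [u]) ` (?B - F) \<union> (\<lambda>u. [k # u, u]) ` (F \<inter> ?B)"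
    have "linkage omega_tree ?B P"
      by (auto simp: P_def linkage_def vpath_def vwalk_def pairwise_def disjnt_iff
          omega_tree_arc_up omega_tree_exits_def)
    moreover have "hd ` P = J"
      by (auto simp: P_def J_def image_Un image_image)
    ultimately show ?thesis
      unfolding linkable_def by blast
  qed
  moreover have "X = J" if X: "linkable omega_tree ?B X" "J \<subseteq> X" for X
  proof (rule ccontr)
    assume "X \<noteq> J"
    then obtain x where x: "x \<in> X" "x \<notin> J"
      using X(2) by auto
    obtain P where P: "linkage omega_tree ?B P" "hd ` P = X"
      using X(1) by (auto simp: linkable_def)
    \<comment> \<open>For maximality: \<open>T\<close> has one element more than
      \<open>F \<inter> ?B\<close>, so some path from \<open>T\<close> ends in an exit outside
      \<open>F\<close>. That exit belongs to \<open>X\<close> and starts a path of its own, which by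
      disjointness is the same path; but no such exit lies in \<open>T\<close>.\<close>
    define T where "T = insert x ((\<lambda>u. k # u) ` (F \<inter> ?B))"
    have "card T = Suc (card (F \<inter> ?B))"
      unfolding T_def using x F by (subst card_insert_disjoint) (auto simp: J_def card_image)
    then obtain p where p: "p \<in> P" "hd p \<in> T" "set p \<inter> (F \<inter> ?B) = {}"
      using linkage_avoids[OF P(1), of T hd "F \<inter> ?B"] x X(2) F P(2)
      by (auto simp: T_def J_def)
    have "last p \<in> ?B - F"
      using p P(1) linkage_not_Nil[OF P(1) p(1)] by (auto simp: linkage_def disjoint_iff)
    then have l: "last p \<in> J"
      by (auto simp: J_def)
    then have "last p \<in> hd ` P"
      using X(2) P(2) by auto
    then obtain q where q: "q \<in> P" "hd q = last p"
      by (metis imageE)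
    have "p = q"
    proof (rule linkage_eqI[OF P(1) p(1) q(1)])
      show "last p \<in> set p"
        using linkage_not_Nil[OF P(1) p(1)] by simp
      show "last p \<in> set q"
        using linkage_not_Nil[OF P(1) q(1)] q(2) hd_in_set by metis
    qed
    then have "last p \<in> T"
      using p(2) q(2) by metis
    then show False
      using \<open>last p \<in> ?B - F\<close> l x(2) by (auto simp: T_def omega_tree_exits_def)
  qed
  ultimately have "J \<in> max_sets (snd ?M)"
    by (auto simp: max_sets_def M_L_def)
  moreover have "J \<inter> F = {}"
    using k by (auto simp: J_def)
  ultimately show "\<exists>J\<in>max_sets (snd ?M). J \<subseteq> fst ?M \<and> J \<inter> F = {}"
    by (auto simp: M_L_def)
qed

section \<open>Reachability avoiding finite sets\<close>

text \<open>Link a maximal independent set \<open>J\<close> that avoids \<open>F\<close>. An exit of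
  \<open>F\<close> that ends no path lies on no path at all, so its trivial path could be added,
  against the maximality of \<open>J\<close>.\<close>

lemma avoidable_linkage_onto:
  assumes dim: "dimaze D B" and av: "all_finite_avoidable (M_L D B)"
    and F: "finite F" "F \<subseteq> verts D"
  obtains P where "linkage D B P" "hd ` P \<inter> F = {}" "F \<inter> B \<subseteq> last ` P"
proof -
  obtain J where J: "J \<in> max_sets (snd (M_L D B))" "J \<inter> F = {}"
    using av F by (auto simp: all_finite_avoidable_def M_L_def)
  then obtain P where P: "linkage D B P" "hd ` P = J" and JD: "J \<subseteq> verts D"
    by (auto simp: max_sets_def M_L_def linkable_def)
  have "u \<in> last ` P" if u: "u \<in> F" "u \<in> B" for u
  proof (rule ccontr)
    assume "u \<notin> last ` P"
    then have out: "u \<notin> set p" if "p \<in> P" for p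
      using vpath_exit_last[OF dim _ _ u(2)] P(1) that by (auto simp: linkage_def)
    have "linkage D B (insert [u] P)"
      using P(1) out u F(2) by (auto simp: linkage_def pairwise_insert disjnt_iff vpath_singleton)
    moreover have "hd ` insert [u] P = insert u J"
      using P(2) by simp
    ultimately have "insert u J \<in> snd (M_L D B)"
      using JD u F(2) unfolding M_L_def linkable_def by (auto simp del: image_insert)
    then have "insert u J = J"
      using J(1) unfolding max_sets_def by blast
    then show False
      using u J(2) by auto
  qed
  then show thesis
    using that[OF P(1)] P(2) J(2) by auto
qed

lemma infinitely_many_reach_exit:
  assumes dim: "dimaze D B" and av: "all_finite_avoidable (M_L D B)"
    and Y: "finite Y" "Y \<subseteq> B" and G: "finite G" "card G < card Y"
  shows "\<exists>y\<in>Y. infinite {x. reaches D G x y}"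
proof (rule ccontr)
  assume neg: "\<not> ?thesis"
  \<comment> \<open>If the claim fails, this set is finite. Including \<open>Y\<close> forces the
    linkage onto \<open>Y\<close>; a path of it that ends in \<open>Y\<close> and avoids
    \<open>G\<close> then starts in \<open>F\<close>, although the linkage starts outside
    \<open>F\<close>.\<close>
  define F where "F = (\<Union>y\<in>Y. {x. reaches D G x y}) \<union> Y"
  have "finite F"
    using neg Y by (auto simp: F_def)
  moreover have "F \<subseteq> verts D"
    using Y(2) dim reaches_verts by (auto simp: F_def dimaze_def)
  ultimately obtain P where P: "linkage D B P" "hd ` P \<inter> F = {}" "F \<inter> B \<subseteq> last ` P"
    using avoidable_linkage_onto[OF dim av] by blast
  have "Y \<subseteq> last ` P"
    using P(3) Y by (auto simp: F_def)
  then obtain p where p: "p \<in> P" "last p \<in> Y" "set p \<inter> G = {}"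
    using linkage_avoids[OF P(1) _ G] by blast
  then have "reaches D G (hd p) (last p)"
    using P(1) by (auto simp: linkage_def reaches_def)
  then have "hd p \<in> F"
    using p by (auto simp: F_def)
  then show False
    using p P(2) by auto
qed

text \<open>If no such path exists, let \<open>A\<close> be the union of finitely many paths to
  \<open>y\<close>. Each \<open>a\<close> in \<open>A\<close> other than \<open>y\<close> and
  outside \<open>G0\<close> has a path to \<open>y\<close> inside \<open>A\<close>, so off
  \<open>G0\<close> and the rest of \<open>A\<close> it reaches only finitely many exits. Linking
  the vertices of \<open>A\<close> together with all those exits contradicts this.\<close>

lemma path_to_exit_from_far_vertex:
  assumes dim: "dimaze D B" and ind: "all_finite_independent (M_L D B)"
    and y: "y \<in> B" and inf: "infinite {x. reaches D G x y}" and G0: "finite G0"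
  shows "\<exists>q. vpath q D \<and> last q = y \<and> set q \<inter> G = {} \<and> hd q \<notin> G0 \<and> hd q \<noteq> y \<and>
    infinite {z \<in> B. reaches D (G0 \<union> (set q - {hd q})) (hd q) z}"
proof (rule ccontr)
  assume neg: "\<not> ?thesis"
  \<comment> \<open>Of the two surplus vertices one makes up for the removal of \<open>y\<close> in
    \<open>S\<close>; the other makes \<open>S\<close> larger than \<open>G0\<close>.\<close>
  obtain T where T: "T \<subseteq> {x. reaches D G x y}" "finite T" "card T = card G0 + 2"
    using infinite_arbitrarily_large[OF inf] by blast
  have "\<forall>x\<in>T. \<exists>p. vpath p D \<and> hd p = x \<and> last p = y \<and> set p \<inter> G = {}"
    using T(1) by (auto simp: reaches_def)
  then obtain t where t: "\<And>x. x \<in> T \<Longrightarrow> vpath (t x) D \<and> hd (t x) = x \<and> last (t x) = y \<and> set (t x) \<inter> G = {}"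
    by metis
  define A where "A = (\<Union>x\<in>T. set (t x))"
  have TA: "T \<subseteq> A"
  proof
    fix x assume x: "x \<in> T"
    then have "x \<in> set (t x)"
      using t vpath_not_Nil by (metis hd_in_set)
    then show "x \<in> A"
      using x by (auto simp: A_def)
  qed
  have A: "finite A" "A \<inter> G = {}"
    using T(2) t by (auto simp: A_def)
  have AD: "A \<subseteq> verts D"
    unfolding A_def by (rule UN_least) (simp add: t vpath_subset_verts)
  have path: "\<exists>q. vpath q D \<and> hd q = a \<and> last q = y \<and> set q \<subseteq> A" if a: "a \<in> A" for a
  proof -
    obtain x where x: "x \<in> T" "a \<in> set (t x)"
      using a by (auto simp: A_def)
    then obtain xs ys where s: "t x = xs @ a # ys"
      by (meson split_list)
    have "vpath (a # ys) D"
      using s t[OF x(1)] vpath_appendD2[of xs "a # ys" D] by simp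
    moreover have "last (a # ys) = y"
      using s t[OF x(1)] by simp
    moreover have "set (a # ys) \<subseteq> set (t x)"
      using s by auto
    then have "set (a # ys) \<subseteq> A"
      using x(1) by (auto simp: A_def)
    ultimately show ?thesis
      by (metis list.sel(1))
  qed
  define S where "S = A - {y}"
  \<comment> \<open>An exit can only be the end of a path, and all the paths that form
    \<open>A\<close> end in \<open>y\<close>.\<close>
  have SB: "S \<inter> B = {}"
  proof -
    have "a = y" if "a \<in> A" "a \<in> B" for a
      using vpath_exit_last[OF dim _ _ that(2)] that(1) t unfolding A_def by (metis UN_E)
    then show ?thesis
      by (auto simp: S_def)
  qed
  have "card T \<le> Suc (card S)"
    using card_mono[OF A(1) TA] A(1) by (auto simp: S_def card_Diff_singleton_if)
  then have cS: "card G0 < card S"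
    using T(3) by simp
  define R where "R a = {z \<in> B. reaches D (G0 \<union> (A - {a})) a z}" for a
  have finR: "finite (R a)" if a: "a \<in> S" "a \<notin> G0" for a
  proof -
    obtain q where q: "vpath q D" "hd q = a" "last q = y" "set q \<subseteq> A"
      using path a by (auto simp: S_def)
    then have "finite {z \<in> B. reaches D (G0 \<union> (set q - {a})) a z}"
      using neg a A(2) by (auto simp: S_def)
    moreover have "R a \<subseteq> {z \<in> B. reaches D (G0 \<union> (set q - {a})) a z}"
      using q(4) unfolding R_def by (auto elim!: reaches_antimono)
    ultimately show ?thesis
      using finite_subset by blast
  qed
  txt \<open>
    Linking \<open>S \<union> U\<close> instead of just \<open>S\<close> keeps the paths from \<open>S\<close> away from the finitely many
    exits reachable from \<open>S - G0\<close> off \<open>G0\<close> and \<open>A\<close>.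
  \<close>
  define U where "U = insert y (\<Union>a\<in>S - G0. R a)"
  have U: "finite U" "U \<subseteq> B"
    using finR A(1) y by (auto simp: U_def S_def R_def)
  have "S \<union> U \<subseteq> verts D"
    using AD U(2) dim by (auto simp: S_def dimaze_def)
  then have "linkable D B (S \<union> U)"
    using ind A(1) U(1) by (auto simp: all_finite_independent_def M_L_def S_def)
  then obtain P where P: "linkage D B P" "hd ` P = S \<union> U"
    by (auto simp: linkable_def)
  obtain p where p: "p \<in> P" "hd p \<in> S" "set p \<inter> G0 = {}"
    using linkage_avoids[OF P(1) _ G0 cS, of hd] P(2) by auto
  \<comment> \<open>Each element of \<open>U\<close> starts a path of the linkage. If
    \<open>p\<close> contained one, it would be that path and start at an exit, although it starts
    in \<open>S\<close>.\<close>
  have pU: "set p \<inter> U = {}"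
  proof (rule ccontr)
    assume "\<not> ?thesis"
    then obtain u where u: "u \<in> set p" "u \<in> U"
      by auto
    then have "u \<in> hd ` P"
      using P(2) by auto
    then obtain q where q: "q \<in> P" "hd q = u"
      by (metis imageE)
    then have "p = q"
      using linkage_eqI[OF P(1) p(1), of q u] u linkage_not_Nil[OF P(1)] by auto
    then show False
      using p(2) q(2) u(2) U(2) SB by auto
  qed
  have vp: "vpath p D" "last p \<in> B" "p \<noteq> []"
    using P(1) p(1) linkage_not_Nil by (auto simp: linkage_def)
  have "\<exists>a\<in>set p. a \<in> A"
    using p(2) vp(3) by (auto simp: S_def intro!: bexI[of _ "hd p"])
  \<comment> \<open>After its last vertex \<open>a\<close> in \<open>A\<close>, the path
    \<open>p\<close> stays off \<open>A\<close>, so its end is one of the exits in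
    \<open>R a\<close>.\<close>
  then obtain xs a ys where s: "p = xs @ a # ys" "a \<in> A" "\<forall>z\<in>set ys. z \<notin> A"
    using split_list_last_prop[of p "\<lambda>a. a \<in> A"] by blast
  have a: "a \<in> S" "a \<notin> G0"
    using pU p(3) s by (auto simp: S_def U_def)
  have "reaches D (G0 \<union> (A - {a})) a (last p)"
    unfolding reaches_def
    using vpath_appendD2[of xs "a # ys" D] vp(1) s p(3)
    by (intro exI[of _ "a # ys"]) auto
  then have "last p \<in> U"
    using a vp(2) by (auto simp: U_def R_def)
  then show False
    using pU last_in_set[OF vp(3)] by blast
qed

section \<open>Growing the comb\<close>

text \<open>One period of the comb: the ray runs along \<open>p\<close> to \<open>last p\<close>, a
  vertex of in-degree 2, and then backwards along \<open>q\<close>, while \<open>l\<close> links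
  \<open>last p\<close> to an exit.\<close>

definition tooth :: "('v, 'e) pre_digraph \<Rightarrow> 'v set \<Rightarrow> 'v list \<Rightarrow> 'v list \<Rightarrow> 'v list \<Rightarrow> bool" where
  "tooth D B p q l \<longleftrightarrow>
     vpath p D \<and> vpath q D \<and> vpath l D \<and> last q = last p \<and> hd l = last p \<and> last l \<in> B \<and>
     hd p \<noteq> last p \<and> hd q \<noteq> last p \<and>
     set p \<inter> set q = {last p} \<and> set p \<inter> set l = {last p} \<and> set q \<inter> set l = {last p}"

text \<open>The infinite set in the conclusion is the hypothesis again, for \<open>hd q\<close> and
  an enlarged forbidden set, so the step can be iterated.\<close>

lemma tooth_extension:
  assumes dim: "dimaze D B" and ind: "all_finite_independent (M_L D B)"
    and av: "all_finite_avoidable (M_L D B)"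
    and F: "finite F" and inf: "infinite {z \<in> B. reaches D F v z}"
  shows "\<exists>p q l. tooth D B p q l \<and> hd p = v \<and> (set p \<union> set q \<union> set l) \<inter> F = {} \<and>
    infinite {z \<in> B. reaches D (F \<union> (set p \<union> set q \<union> set l - {hd q})) (hd q) z}"
proof -
  \<comment> \<open>With \<open>v\<close> in \<open>G\<close> the path to be found avoids
    \<open>v\<close>; hence it meets the path from \<open>v\<close> at a later vertex
    \<open>w\<close>.\<close>
  define G where "G = insert v F"
  have G: "finite G"
    using F by (simp add: G_def)
  obtain Y where Y: "Y \<subseteq> {z \<in> B. reaches D F v z}" "finite Y" "card Y = Suc (card G)"
    using infinite_arbitrarily_large[OF inf] by blast
  then obtain y where y: "y \<in> Y" "infinite {x. reaches D G x y}"
    using infinitely_many_reach_exit[OF dim av Y(2) _ G] by auto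
  then have yB: "y \<in> B" "reaches D F v y"
    using Y(1) by auto
  then obtain p\<^sub>0 where p0: "vpath p\<^sub>0 D" "hd p\<^sub>0 = v" "last p\<^sub>0 = y" "set p\<^sub>0 \<inter> F = {}"
    unfolding reaches_def by auto
  have "finite (F \<union> set p\<^sub>0)"
    using F by simp
  from path_to_exit_from_far_vertex[OF dim ind yB(1) y(2) this]
  obtain q\<^sub>0 where q0: "vpath q\<^sub>0 D" "last q\<^sub>0 = y" "set q\<^sub>0 \<inter> G = {}" "hd q\<^sub>0 \<notin> F \<union> set p\<^sub>0"
    and inf0: "infinite {z \<in> B. reaches D (F \<union> set p\<^sub>0 \<union> (set q\<^sub>0 - {hd q\<^sub>0})) (hd q\<^sub>0) z}"
    by auto
  have ne: "p\<^sub>0 \<noteq> []" "q\<^sub>0 \<noteq> []"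
    using p0(1) q0(1) vpath_not_Nil by auto
  have "y \<in> set q\<^sub>0" "y \<in> set p\<^sub>0"
    using ne p0(3) q0(2) last_in_set by metis+
  then have "\<exists>w\<in>set q\<^sub>0. w \<in> set p\<^sub>0"
    by blast
  then obtain q\<^sub>1 w q\<^sub>2 where q1: "q\<^sub>0 = q\<^sub>1 @ w # q\<^sub>2" "w \<in> set p\<^sub>0" "\<forall>z\<in>set q\<^sub>1. z \<notin> set p\<^sub>0"
    using split_list_first_prop[of q\<^sub>0 "\<lambda>w. w \<in> set p\<^sub>0"] by blast
  \<comment> \<open>The start of \<open>q\<^sub>0\<close> is off \<open>p\<^sub>0\<close>, so the
    first common vertex \<open>w\<close> is not the start.\<close>
  have q1ne: "q\<^sub>1 \<noteq> []"
    using q1 q0(4) by auto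
  obtain p\<^sub>1 p\<^sub>2 where p1: "p\<^sub>0 = p\<^sub>1 @ w # p\<^sub>2"
    using q1(2) by (meson split_list)
  have "w \<noteq> v"
    using q1(1) q0(3) by (auto simp: G_def)
  then have p1ne: "p\<^sub>1 \<noteq> []"
    using p0(2) p1 by auto
  define p q l where "p = p\<^sub>1 @ [w]" and "q = q\<^sub>1 @ [w]" and "l = w # p\<^sub>2"
  have dist: "distinct p\<^sub>0" "distinct q\<^sub>0"
    using p0(1) q0(1) by (auto simp: vpath_def)
  have hd: "hd p = v" "hd q = hd q\<^sub>0"
    using p0(2) p1 p1ne q1ne q1(1) by (auto simp: p_def q_def)
  have sets: "set p \<union> set l = set p\<^sub>0" "set q \<subseteq> set q\<^sub>0"
    by (auto simp: p_def l_def p1 q_def q1(1))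
  have "tooth D B p q l"
    unfolding tooth_def
  proof (intro conjI)
    show "vpath p D" "vpath q D" "vpath l D"
      using vpath_appendD1[of p "p\<^sub>2" D] vpath_appendD1[of q "q\<^sub>2" D] vpath_appendD2[of p\<^sub>1 l D]
        p0(1) q0(1) p1 q1(1) by (simp_all add: p_def q_def l_def)
    show "last l \<in> B"
      using p0(3) yB(1) by (simp add: l_def p1)
    show "hd p \<noteq> last p"
      using hd \<open>w \<noteq> v\<close> by (simp add: p_def)
    show "hd q \<noteq> last p"
      using hd q0(4) q1(2) by (auto simp: p_def)
    show "set p \<inter> set q = {last p}" "set q \<inter> set l = {last p}"
      using q1(3) by (auto simp: p_def q_def l_def p1)
    show "set p \<inter> set l = {last p}"
      using dist(1) by (auto simp: p_def l_def p1)
  qed (simp_all add: p_def q_def l_def)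
  moreover have "(set p \<union> set q \<union> set l) \<inter> F = {}"
    using sets p0(4) q0(3) by (auto simp: G_def)
  moreover have "infinite {z \<in> B. reaches D (F \<union> (set p \<union> set q \<union> set l - {hd q})) (hd q) z}"
  \<comment> \<open>Cutting the paths at \<open>w\<close> only shrinks the forbidden set.\<close>
  proof (rule infinite_super[OF _ inf0], safe)
    fix z assume "reaches D (F \<union> set p\<^sub>0 \<union> (set q\<^sub>0 - {hd q\<^sub>0})) (hd q\<^sub>0) z"
    then show "reaches D (F \<union> (set p \<union> set q \<union> set l - {hd q})) (hd q) z"
      unfolding hd(2) by (rule reaches_antimono) (use sets in auto)
  qed
  ultimately show ?thesis
    using hd(1) by - (rule exI[of _ p], rule exI[of _ q], rule exI[of _ l], intro conjI; assumption)
qed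

section \<open>Assembling the comb\<close>

lemma set_vwalk_arcs_conv_nth:
  "set (vwalk_arcs xs) = {(xs ! k, xs ! Suc k) | k. Suc k < length xs}"
proof (induction xs rule: vwalk_arcs.induct)
  case (3 x y xs)
  have "{((x # y # xs) ! k, (x # y # xs) ! Suc k) | k. Suc k < length (x # y # xs)} =
    insert (x, y) {((y # xs) ! k, (y # xs) ! Suc k) | k. Suc k < length (y # xs)}"
    (is "?L = ?R")
  proof
    show "?L \<subseteq> ?R"
    proof
      fix z assume "z \<in> ?L"
      then obtain k where k: "z = ((x # y # xs) ! k, (x # y # xs) ! Suc k)" "Suc k < length (x # y # xs)"
        by auto
      then show "z \<in> ?R"
        by (cases k) auto
    qed
    show "?R \<subseteq> ?L"
      by force
  qed
  then show ?case
    using 3 by simp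
qed auto

lemma vwalk_arcsD: "(x, y) \<in> set (vwalk_arcs xs) \<Longrightarrow> x \<in> set xs \<and> y \<in> set (tl xs)"
  by (induction xs rule: vwalk_arcs.induct) auto

lemma vwalk_arcs_distinct_neq: "(x, y) \<in> set (vwalk_arcs xs) \<Longrightarrow> distinct xs \<Longrightarrow> x \<noteq> y"
  by (induction xs rule: vwalk_arcs.induct) auto

lemma vwalk_arcs_pred_unique:
  "(x, y) \<in> set (vwalk_arcs xs) \<Longrightarrow> (x', y) \<in> set (vwalk_arcs xs) \<Longrightarrow> distinct xs \<Longrightarrow> x = x'"
  by (induction xs rule: vwalk_arcs.induct) (auto dest: vwalk_arcsD)

lemma vwalk_arcs_pred_exists: "y \<in> set (tl xs) \<Longrightarrow> \<exists>x. (x, y) \<in> set (vwalk_arcs xs)"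
  by (induction xs rule: vwalk_arcs.induct) auto

lemma set_vwalk_arcs_split:
  "set (vwalk_arcs (xs @ z # ys)) = set (vwalk_arcs (xs @ [z])) \<union> set (vwalk_arcs (z # ys))"
  by (induction xs rule: vwalk_arcs.induct) auto

lemma set_vwalk_arcs_rev: "set (vwalk_arcs (rev xs)) = (set (vwalk_arcs xs))\<inverse>"
proof (induction xs rule: vwalk_arcs.induct)
  case (3 x y xs)
  have "set (vwalk_arcs (rev (x # y # xs))) =
      set (vwalk_arcs (rev xs @ [y])) \<union> set (vwalk_arcs [y, x])"
    using set_vwalk_arcs_split[of "rev xs" y "[x]"] by simp
  then show ?case
    using 3 by auto
qed auto

text \<open>
  A comb must have no parallel arcs, so one arc is selected for every pair of adjacent
  vertices.
\<close>

definition chosen_arc :: "('v, 'e) pre_digraph \<Rightarrow> 'v \<times> 'v \<Rightarrow> 'e" where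
  "chosen_arc D xy = (SOME a. a \<in> arcs D \<and> arc_to_ends D a = xy)"

definition thin_subgraph ::
  "('v, 'e) pre_digraph \<Rightarrow> 'v set \<Rightarrow> ('v \<times> 'v) set \<Rightarrow> ('v, 'e) pre_digraph" where
  "thin_subgraph D V E = \<lparr>verts = V, arcs = chosen_arc D ` E, tail = tail D, head = head D\<rparr>"

lemma chosen_arc:
  assumes "xy \<in> arcs_ends D"
  shows "chosen_arc D xy \<in> arcs D" "arc_to_ends D (chosen_arc D xy) = xy"
  unfolding chosen_arc_def atomize_conj
  by (rule someI_ex) (use assms in \<open>auto simp: arcs_ends_def\<close>)

lemma chosen_arc_ends:
  assumes "(x, y) \<in> arcs_ends D"
  shows "tail D (chosen_arc D (x, y)) = x" "head D (chosen_arc D (x, y)) = y"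
  using chosen_arc(2)[OF assms] by (auto simp: arc_to_ends_def)

lemma thin_subgraph_simps [simp]:
  "verts (thin_subgraph D V E) = V" "arcs (thin_subgraph D V E) = chosen_arc D ` E"
  "tail (thin_subgraph D V E) = tail D" "head (thin_subgraph D V E) = head D"
  by (simp_all add: thin_subgraph_def)

lemma arc_to_ends_thin_subgraph [simp]: "arc_to_ends (thin_subgraph D V E) = arc_to_ends D"
  by (simp add: arc_to_ends_def fun_eq_iff)

lemma arcs_ends_thin_subgraph:
  assumes "E \<subseteq> arcs_ends D"
  shows "arcs_ends (thin_subgraph D V E) = E"
proof -
  have "arc_to_ends D ` chosen_arc D ` E = (\<lambda>xy. xy) ` E"
    unfolding image_image by (rule image_cong[OF refl]) (metis assms chosen_arc(2) subsetD)
  then show ?thesis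
    by (simp add: arcs_ends_def)
qed

lemma wf_thin_subgraph:
  assumes "E \<subseteq> arcs_ends D" "E \<subseteq> V \<times> V"
  shows "wf_digraph (thin_subgraph D V E)"
proof (unfold_locales, unfold thin_subgraph_simps)
  fix a assume "a \<in> chosen_arc D ` E"
  then obtain x y where "(x, y) \<in> E" "a = chosen_arc D (x, y)"
    by auto
  moreover from this(1) have "(x, y) \<in> arcs_ends D" "(x, y) \<in> V \<times> V"
    using assms by auto
  ultimately show "tail D a \<in> V" "head D a \<in> V"
    using chosen_arc_ends[of x y D] by auto
qed

lemma nomulti_thin_subgraph:
  assumes "E \<subseteq> arcs_ends D" "E \<subseteq> V \<times> V"
  shows "nomulti_digraph (thin_subgraph D V E)"
proof -
  have "a = b" if "a \<in> chosen_arc D ` E" "b \<in> chosen_arc D ` E" "arc_to_ends D a = arc_to_ends D b" for a b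
    using that assms(1) chosen_arc(2) by (metis imageE subsetD)
  then show ?thesis
    using wf_thin_subgraph[OF assms] by (simp add: nomulti_digraph_def nomulti_digraph_axioms_def)
qed

lemma thin_subgraph_subgraph:
  assumes "wf_digraph D" "E \<subseteq> arcs_ends D" "E \<subseteq> V \<times> V" "V \<subseteq> verts D"
  shows "subgraph (thin_subgraph D V E) D"
  using assms wf_thin_subgraph[OF assms(2,3)] by (auto simp: subgraph_def compatible_def chosen_arc)

lemma thin_subgraph_mono:
  assumes "E' \<subseteq> arcs_ends D" "E' \<subseteq> V' \<times> V'" "E \<subseteq> E'" "E \<subseteq> V \<times> V" "V \<subseteq> V'"
  shows "subgraph (thin_subgraph D V E) (thin_subgraph D V' E')"
  using assms wf_thin_subgraph[OF assms(1,2)] wf_thin_subgraph[of E D V]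
  by (auto simp: subgraph_def compatible_def)

text \<open>With one arc per pair, arcs into \<open>y\<close> correspond to predecessors of
  \<open>y\<close>.\<close>

lemma in_degree_thin_subgraph:
  assumes "E \<subseteq> arcs_ends D"
  shows "in_degree (thin_subgraph D V E) y = card {x. (x, y) \<in> E}"
proof -
  have "in_arcs (thin_subgraph D V E) y = (\<lambda>x. chosen_arc D (x, y)) ` {x. (x, y) \<in> E}"
    using assms by (auto simp: in_arcs_def chosen_arc_ends subset_iff)
  moreover have "inj_on (\<lambda>x. chosen_arc D (x, y)) {x. (x, y) \<in> E}"
    using assms by (intro inj_onI) (metis chosen_arc_ends(1) mem_Collect_eq subsetD)
  ultimately show ?thesis
    by (simp add: in_degree_def card_image)
qed

section \<open>The comb formed by an infinite sequence of teeth\<close>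

text \<open>By \<open>separate\<close> a tooth shares with later ones at most
  \<open>hd (q m)\<close>, where the next tooth begins. The path \<open>l\<^sub>0\<close> links the
  first vertex of the ray to an exit.\<close>

locale teeth =
  fixes D :: "('v, 'e) pre_digraph" and B :: "'v set"
    and p q l :: "nat \<Rightarrow> 'v list" and l\<^sub>0 :: "'v list"
  assumes dim: "dimaze D B"
    and tooth: "\<And>n. tooth D B (p n) (q n) (l n)"
    and joined: "\<And>n. hd (q n) = hd (p (Suc n))"
    and separate: "\<And>m n. m < n \<Longrightarrow>
      (set (p m) \<union> set (q m) \<union> set (l m) - {hd (q m)}) \<inter> (set (p n) \<union> set (q n) \<union> set (l n)) = {}"
    and first: "vpath l\<^sub>0 D" "hd l\<^sub>0 = hd (p 0)" "last l\<^sub>0 \<in> B"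
      "\<And>n. set l\<^sub>0 \<inter> (set (p n) \<union> set (q n) \<union> set (l n)) \<subseteq> {hd (p 0)}"
begin

text \<open>The turning points of the ray: at \<open>w n\<close> it is entered from both sides, and
  from \<open>v (Suc n)\<close> its arcs leave on both sides; \<open>v 0\<close> is its first
  vertex.\<close>

definition v where "v n = hd (p n)"
definition w where "w n = last (p n)"

lemma vp: "vpath (p n) D" "vpath (q n) D" "vpath (l n) D"
  using tooth[of n] by (auto simp: tooth_def)

lemma nonempty [simp]: "p n \<noteq> []" "q n \<noteq> []" "l n \<noteq> []" "l\<^sub>0 \<noteq> []"
  using vp[of n] first(1) vpath_not_Nil by auto

lemma distinct_paths: "distinct (p n)" "distinct (q n)" "distinct (l n)"
  using vp[of n] by (auto simp: vpath_def)

lemma ends: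
  "hd (p n) = v n" "last (p n) = w n" "hd (q n) = v (Suc n)" "last (q n) = w n" "hd (l n) = w n"
  "last (l n) \<in> B" "v n \<noteq> w n" "v (Suc n) \<noteq> w n"
  using tooth[of n] joined[of n] by (auto simp: tooth_def v_def w_def)

lemma same_tooth:
  "set (p n) \<inter> set (q n) = {w n}" "set (p n) \<inter> set (l n) = {w n}" "set (q n) \<inter> set (l n) = {w n}"
  using tooth[of n] by (auto simp: tooth_def w_def)

lemma end_mem:
  "v n \<in> set (p n)" "w n \<in> set (p n)" "v (Suc n) \<in> set (q n)" "w n \<in> set (q n)" "w n \<in> set (l n)"
  using ends(1-5)[of n] nonempty hd_in_set last_in_set by metis+

lemma v_not_mem:
  "v n \<notin> set (q n)" "v n \<notin> set (l n)" "v (Suc n) \<notin> set (p n)" "v (Suc n) \<notin> set (l n)"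
  using same_tooth[of n] ends(7,8)[of n] end_mem[of n] by blast+

definition U where "U n = set (p n) \<union> set (q n) \<union> set (l n)"

text \<open>A common vertex must be \<open>v (Suc m)\<close>. It lies in tooth \<open>Suc m\<close>
  but is not the vertex at which that tooth may meet later ones, so \<open>n\<close> cannot exceed
  \<open>Suc m\<close>.\<close>

lemma overlap:
  assumes "m < n" "x \<in> U m" "x \<in> U n"
  shows "n = Suc m \<and> x = v n"
proof -
  have x: "x = v (Suc m)"
    using separate[OF assms(1)] assms(2,3) ends(3)[of m] by (auto simp: U_def)
  have "n = Suc m"
  proof (rule ccontr)
    assume "n \<noteq> Suc m"
    then have "Suc m < n"
      using assms(1) by simp
    moreover have "x \<noteq> hd (q (Suc m))"
      using x v_not_mem(1)[of "Suc m"] hd_in_set[OF nonempty(2)] by metis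
    moreover have "x \<in> set (p (Suc m))"
      using x end_mem(1) by simp
    ultimately show False
      using separate[of "Suc m" n] assms(3) by (auto simp: U_def)
  qed
  then show ?thesis
    using x by simp
qed

text \<open>In this and the next five lemmas, two different teeth meet only if they are consecutive,
  and then only in \<open>v (Suc m)\<close>, which lies on \<open>q m\<close> and
  \<open>p (Suc m)\<close> but on none of the other four paths.\<close>

lemma p_p: "x \<in> set (p m) \<Longrightarrow> x \<in> set (p n) \<Longrightarrow> m = n"
  using overlap[of m n x] overlap[of n m x] v_not_mem(3)
  by (cases m n rule: linorder_cases) (auto simp: U_def)

lemma q_q: "x \<in> set (q m) \<Longrightarrow> x \<in> set (q n) \<Longrightarrow> m = n"
  using overlap[of m n x] overlap[of n m x] v_not_mem(1)
  by (cases m n rule: linorder_cases) (auto simp: U_def)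

lemma l_l: "x \<in> set (l m) \<Longrightarrow> x \<in> set (l n) \<Longrightarrow> m = n"
  using overlap[of m n x] overlap[of n m x] v_not_mem(2)
  by (cases m n rule: linorder_cases) (auto simp: U_def)

lemma p_q: "x \<in> set (p m) \<Longrightarrow> x \<in> set (q n) \<Longrightarrow> m = n \<and> x = w n \<or> m = Suc n \<and> x = v m"
  using overlap[of m n x] overlap[of n m x] v_not_mem(3) same_tooth(1)[of n]
  by (cases m n rule: linorder_cases) (auto simp: U_def)

lemma p_l: "x \<in> set (p m) \<Longrightarrow> x \<in> set (l n) \<Longrightarrow> m = n \<and> x = w n"
  using overlap[of m n x] overlap[of n m x] v_not_mem(3,4) same_tooth(2)[of n]
  by (cases m n rule: linorder_cases) (auto simp: U_def)

lemma q_l: "x \<in> set (q m) \<Longrightarrow> x \<in> set (l n) \<Longrightarrow> m = n \<and> x = w n"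
  using overlap[of m n x] overlap[of n m x] v_not_mem(1,2,4) same_tooth(3)[of n]
  by (cases m n rule: linorder_cases) (auto simp: U_def)

lemma first_inter: "x \<in> set l\<^sub>0 \<Longrightarrow> x \<in> U n \<Longrightarrow> n = 0 \<and> x = v 0"
proof -
  assume x: "x \<in> set l\<^sub>0" "x \<in> U n"
  then have "x = v 0"
    using first(4)[of n] ends(1)[of 0] by (auto simp: U_def)
  then show ?thesis
    using overlap[of 0 n x] x(2) end_mem(1)[of 0] v_not_mem(3)[of 0] by (cases n) (auto simp: U_def)
qed

section \<open>Enumeration of the ray\<close>

text \<open>The first \<open>butlast\<close> avoids listing \<open>w n\<close> twice; the second
  leaves \<open>v (Suc n)\<close> to the next segment.\<close>

definition seg where "seg n = butlast (p n) @ butlast (rev (q n))"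

definition initial where "initial m = concat (map seg [0..<m])"

text \<open>Segments are nonempty, so \<open>Suc k\<close> of them have an entry at position
  \<open>k\<close>.\<close>

definition r where "r k = initial (Suc k) ! k"

lemma seg_snoc: "seg n @ [v (Suc n)] = butlast (p n) @ rev (q n)"
proof -
  have "rev (q n) = butlast (rev (q n)) @ [v (Suc n)]"
    using append_butlast_last_id[of "rev (q n)"] ends(3)[of n] by (simp add: last_rev)
  then show ?thesis
    by (simp add: seg_def)
qed

lemma rev_q: "rev (q n) = w n # tl (rev (q n))"
  using ends(4)[of n] nonempty(2)[of n] by (metis hd_rev list.collapse rev_is_Nil_conv)

lemma p_snoc: "p n = butlast (p n) @ [w n]"
  using ends(2)[of n] nonempty(1)[of n] by (metis append_butlast_last_id)

lemma butlast_p: "butlast (p n) \<noteq> []" "hd (butlast (p n)) = v n"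
proof -
  show *: "butlast (p n) \<noteq> []"
    using p_snoc[of n] ends(1,7)[of n] by (metis append_Nil list.sel(1))
  show "hd (butlast (p n)) = v n"
    using p_snoc[of n] ends(1)[of n] * by (metis hd_append2)
qed

lemma seg_hd: "seg n \<noteq> []" "hd (seg n) = v n"
  using butlast_p[of n] by (simp_all add: seg_def)

lemma distinct_seg_snoc: "distinct (seg n @ [v (Suc n)])"
proof -
  have "distinct (butlast (p n) @ [w n])"
    using p_snoc[of n] distinct_paths(1)[of n] by simp
  moreover have "set (butlast (p n)) \<inter> set (q n) \<subseteq> {w n}"
    using same_tooth(1)[of n] by (auto dest: in_set_butlastD)
  ultimately show ?thesis
    using distinct_paths(2)[of n] unfolding seg_snoc by auto
qed

lemma set_seg_snoc: "set (seg n @ [v (Suc n)]) = set (p n) \<union> set (q n)"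
proof -
  have "set (p n) = insert (w n) (set (butlast (p n)))"
    by (subst p_snoc) simp
  then show ?thesis
    using end_mem(4)[of n] unfolding seg_snoc by auto
qed

lemma set_seg: "set (seg n) = set (p n) \<union> set (q n) - {v (Suc n)}"
  using set_seg_snoc[of n] distinct_seg_snoc[of n] by auto

lemma arcs_seg_snoc:
  "set (vwalk_arcs (seg n @ [v (Suc n)])) = set (vwalk_arcs (p n)) \<union> (set (vwalk_arcs (q n)))\<inverse>"
proof -
  have "set (vwalk_arcs (seg n @ [v (Suc n)])) =
      set (vwalk_arcs (butlast (p n) @ [w n])) \<union> set (vwalk_arcs (rev (q n)))"
    unfolding seg_snoc using set_vwalk_arcs_split[of "butlast (p n)" "w n" "tl (rev (q n))"]
    by (simp flip: rev_q)
  then show ?thesis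
    by (simp add: set_vwalk_arcs_rev flip: p_snoc)
qed

lemma initial_Suc: "initial (Suc m) = initial m @ seg m"
  by (simp add: initial_def)

lemma initial_0: "initial 0 = []"
  by (simp add: initial_def)

lemma set_initial: "set (initial m) = (\<Union>n<m. set (seg n))"
  by (auto simp: initial_def)

lemma length_initial: "m \<le> length (initial m)"
proof (induction m)
  case (Suc m)
  moreover have "0 < length (seg m)"
    using seg_hd(1) by simp
  ultimately show ?case
    unfolding initial_Suc length_append by linarith
qed simp

lemma seg_disjoint: "m < n \<Longrightarrow> set (seg m) \<inter> set (seg n) = {}"
  using overlap[of m n] by (auto simp: set_seg U_def)

lemma distinct_initial: "distinct (initial m)"
proof (induction m)
  case (Suc m)
  then show ?case
    using seg_disjoint distinct_seg_snoc[of m] by (auto simp: initial_Suc set_initial)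
qed (simp add: initial_0)

lemma initial_prefix: "m \<le> n \<Longrightarrow> \<exists>zs. initial n = initial m @ zs"
proof (induction n rule: dec_induct)
  case (step n)
  then show ?case
    by (auto simp: initial_Suc)
qed simp

lemma r_eq_nth:
  assumes "k < length (initial m)"
  shows "r k = initial m ! k"
proof (cases "m \<le> Suc k")
  case True
  then show ?thesis
    using initial_prefix[OF True] assms by (auto simp: r_def nth_append)
next
  case False
  then show ?thesis
    using initial_prefix[of "Suc k" m] length_initial[of "Suc k"] by (auto simp: r_def nth_append)
qed

lemma r_length_initial: "r (length (initial m)) = v m"
proof -
  have "length (initial m) < length (initial (Suc m))"
    using seg_hd(1)[of m] by (simp add: initial_Suc)
  then have "r (length (initial m)) = initial (Suc m) ! length (initial m)"
    by (rule r_eq_nth)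
  also have "\<dots> = v m"
    using seg_hd[of m] by (simp add: initial_Suc nth_append hd_conv_nth)
  finally show ?thesis .
qed

lemma r_0: "r 0 = v 0"
  using r_length_initial[of 0] by (simp add: initial_0)

lemma inj_r: "inj r"
proof (rule injI)
  fix j k assume eq: "r j = r k"
  define m where "m = Suc (max j k)"
  have jk: "j < length (initial m)" "k < length (initial m)"
    using length_initial[of m] by (auto simp: m_def)
  then have "initial m ! j = initial m ! k"
    using eq r_eq_nth by simp
  then show "j = k"
    using jk distinct_initial nth_eq_iff_index_eq by blast
qed

lemma range_r: "range r = (\<Union>n. set (p n) \<union> set (q n))"
proof -
  have "range r = (\<Union>m. set (initial m))"
  proof (intro equalityI subsetI)
    fix x assume "x \<in> range r"
    then obtain k where "x = r k"
      by auto
    moreover have "k < length (initial (Suc k))"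
      using length_initial[of "Suc k"] by simp
    ultimately have "x \<in> set (initial (Suc k))"
      by (simp add: r_def)
    then show "x \<in> (\<Union>m. set (initial m))"
      by blast
  next
    fix x assume "x \<in> (\<Union>m. set (initial m))"
    then obtain m k where "k < length (initial m)" "x = initial m ! k"
      by (auto simp: in_set_conv_nth)
    then show "x \<in> range r"
      using r_eq_nth by (metis rangeI)
  qed
  also have "\<dots> = (\<Union>n. set (seg n))"
    by (auto simp: set_initial)
  also have "\<dots> = (\<Union>n. set (p n) \<union> set (q n))"
  proof (intro equalityI subsetI)
    fix x assume "x \<in> (\<Union>n. set (p n) \<union> set (q n))"
    then obtain n where "x \<in> set (p n) \<union> set (q n)"
      by auto
    moreover have "v (Suc n) \<in> set (seg (Suc n))"
      using seg_hd[of "Suc n"] hd_in_set by metis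
    ultimately show "x \<in> (\<Union>n. set (seg n))"
      by (cases "x = v (Suc n)") (auto simp: set_seg)
  qed (auto simp: set_seg)
  finally show ?thesis .
qed

section \<open>Arcs and in-degrees of the ray\<close>

text \<open>\<open>EP\<close> consists of the arcs directed along the enumeration \<open>r\<close>,
  and \<open>EQ\<close> of those directed against it.\<close>

definition EP where "EP = (\<Union>n. set (vwalk_arcs (p n)))"
definition EQ where "EQ = (\<Union>n. set (vwalk_arcs (q n)))"

lemma arcs_initial:
  "set (vwalk_arcs (initial m @ [v m])) =
     (\<Union>n<m. set (vwalk_arcs (p n)) \<union> (set (vwalk_arcs (q n)))\<inverse>)"
proof (induction m)
  case (Suc m)
  obtain zs where zs: "seg m @ [v (Suc m)] = v m # zs"
    using seg_hd[of m] by (cases "seg m") auto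
  have "set (vwalk_arcs (initial (Suc m) @ [v (Suc m)])) =
      set (vwalk_arcs (initial m @ [v m])) \<union> set (vwalk_arcs (seg m @ [v (Suc m)]))"
    using set_vwalk_arcs_split[of "initial m" "v m" zs] by (simp add: initial_Suc flip: zs)
  then show ?case
    using Suc arcs_seg_snoc[of m] by (simp add: lessThan_Suc Un_commute)
qed (simp add: initial_0)

lemma ray_steps: "{(r k, r (Suc k)) | k. True} = EP \<union> EQ\<inverse>"
proof -
  \<comment> \<open>The appended \<open>v m\<close> is the ray's vertex at position
    \<open>length (initial m)\<close>, so it supplies the step out of the last segment.\<close>
  have nth: "(initial m @ [v m]) ! k = r k" if "k \<le> length (initial m)" for m k
    using that r_eq_nth[of k m] r_length_initial[of m] by (auto simp: nth_append)
  have step: "set (vwalk_arcs (initial m @ [v m])) = {(r k, r (Suc k)) | k. k < length (initial m)}" for m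
  proof -
    have "((initial m @ [v m]) ! k, (initial m @ [v m]) ! Suc k) = (r k, r (Suc k))"
      if "k < length (initial m)" for k
      using nth[of k m] nth[of "Suc k" m] that by simp
    then show ?thesis
      unfolding set_vwalk_arcs_conv_nth setcompr_eq_image by (intro image_cong) auto
  qed
  have "{(r k, r (Suc k)) | k. True} = (\<Union>m. set (vwalk_arcs (initial m @ [v m])))"
  proof (intro equalityI subsetI)
    fix z assume "z \<in> {(r k, r (Suc k)) | k. True}"
    then obtain k where "z = (r k, r (Suc k))"
      by auto
    then have "z \<in> set (vwalk_arcs (initial (Suc k) @ [v (Suc k)]))"
      using length_initial[of "Suc k"] unfolding step by auto
    then show "z \<in> (\<Union>m. set (vwalk_arcs (initial m @ [v m])))"
      by blast
  qed (auto simp: step)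
  also have "\<dots> = EP \<union> EQ\<inverse>"
    unfolding arcs_initial EP_def EQ_def by auto
  finally show ?thesis .
qed

text \<open>The paths \<open>p n\<close> are pairwise disjoint, and on a path a vertex has at most
  one predecessor.\<close>

lemma EP_pred_unique: "(x, y) \<in> EP \<Longrightarrow> (x', y) \<in> EP \<Longrightarrow> x = x'"
  unfolding EP_def
  using p_p vwalk_arcsD vwalk_arcs_pred_unique distinct_paths(1)
  by (smt (verit) UN_E list.set_sel(2) nonempty(1))

lemma EQ_pred_unique: "(x, y) \<in> EQ \<Longrightarrow> (x', y) \<in> EQ \<Longrightarrow> x = x'"
  unfolding EQ_def
  using q_q vwalk_arcsD vwalk_arcs_pred_unique distinct_paths(2)
  by (smt (verit) UN_E list.set_sel(2) nonempty(2))

lemma EP_mem: "(x, y) \<in> EP \<Longrightarrow> \<exists>n. x \<in> set (p n) \<and> y \<in> set (p n) \<and> y \<noteq> v n \<and> x \<noteq> y"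
proof -
  assume "(x, y) \<in> EP"
  then obtain n where n: "(x, y) \<in> set (vwalk_arcs (p n))"
    by (auto simp: EP_def)
  have "p n = v n # tl (p n)"
    using ends(1)[of n] nonempty(1) by (metis list.collapse)
  then have "v n \<notin> set (tl (p n))"
    using distinct_paths(1)[of n] by (metis distinct.simps(2))
  then show ?thesis
    using vwalk_arcsD[OF n] vwalk_arcs_distinct_neq[OF n distinct_paths(1)] list.set_sel(2)[of "p n"] by auto
qed

lemma EQ_mem: "(x, y) \<in> EQ \<Longrightarrow> \<exists>n. x \<in> set (q n) \<and> y \<in> set (q n) \<and> y \<noteq> v (Suc n) \<and> x \<noteq> y"
proof -
  assume "(x, y) \<in> EQ"
  then obtain n where n: "(x, y) \<in> set (vwalk_arcs (q n))"
    by (auto simp: EQ_def)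
  have "q n = v (Suc n) # tl (q n)"
    using ends(3)[of n] nonempty(2) by (metis list.collapse)
  then have "v (Suc n) \<notin> set (tl (q n))"
    using distinct_paths(2)[of n] by (metis distinct.simps(2))
  then show ?thesis
    using vwalk_arcsD[OF n] vwalk_arcs_distinct_neq[OF n distinct_paths(2)] list.set_sel(2)[of "q n"] by auto
qed

text \<open>A path \<open>p m\<close> and a path \<open>q n\<close> have at most one common vertex,
  hence no common edge in either direction.\<close>

lemma EP_EQ_same_edge:
  assumes "(x, y) \<in> EP" "(x', y') \<in> EQ" "{x, y} = {x', y'}"
  shows False
proof -
  obtain m where m: "x \<in> set (p m)" "y \<in> set (p m)" "x \<noteq> y"
    using EP_mem[OF assms(1)] by auto
  obtain n where n: "x \<in> set (q n)" "y \<in> set (q n)"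
    using EQ_mem[OF assms(2)] assms(3) by (auto simp: doubleton_eq_iff)
  show False
    using p_q[OF m(1) n(1)] p_q[OF m(2) n(2)] m(3) by auto
qed

lemma w_preds: "\<exists>x x'. (x, w n) \<in> EP \<and> (x', w n) \<in> EQ"
proof -
  have "w n \<in> set (tl (p n))" "w n \<in> set (tl (q n))"
    using ends[of n] end_mem[of n] nonempty by (metis list.collapse set_ConsD)+
  then obtain x x' where "(x, w n) \<in> set (vwalk_arcs (p n))" "(x', w n) \<in> set (vwalk_arcs (q n))"
    using vwalk_arcs_pred_exists by meson
  then have "(x, w n) \<in> EP" "(x', w n) \<in> EQ"
    by (auto simp: EP_def EQ_def)
  then show ?thesis
    by auto
qed

text \<open>\<open>EP\<close> and \<open>EQ\<close> each give at most one predecessor. Two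
  predecessors therefore put \<open>y\<close> on some \<open>q n\<close> and on some
  \<open>p m\<close> away from its start, and such paths meet only in a vertex
  \<open>w n\<close>.\<close>

lemma card_preds: "card {x. (x, y) \<in> EP \<union> EQ} = 2 \<longleftrightarrow> y \<in> range w"
proof
  assume c: "card {x. (x, y) \<in> EP \<union> EQ} = 2"
  have "\<not> {x. (x, y) \<in> EP \<union> EQ} \<subseteq> {z}" for z
    using c card_mono[of "{z}" "{x. (x, y) \<in> EP \<union> EQ}"] by auto
  then obtain x x' where "(x, y) \<in> EP" "(x', y) \<in> EQ"
    using EP_pred_unique[of _ y] EQ_pred_unique[of _ y] by blast
  then obtain m n where "y \<in> set (p m)" "y \<noteq> v m" "y \<in> set (q n)"
    using EP_mem EQ_mem by meson
  then show "y \<in> range w"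
    using p_q by blast
next
  assume "y \<in> range w"
  then obtain x x' where x: "(x, y) \<in> EP" "(x', y) \<in> EQ"
    using w_preds by blast
  then have "{x. (x, y) \<in> EP \<union> EQ} = {x, x'}"
    using EP_pred_unique EQ_pred_unique by blast
  moreover have "x \<noteq> x'"
    using EP_EQ_same_edge[OF x] by auto
  ultimately show "card {x. (x, y) \<in> EP \<union> EQ} = 2"
    by simp
qed

lemma inj_w: "inj w"
  by (rule injI) (metis p_p end_mem(2))

lemma ray_arcs_in_D: "EP \<union> EQ \<subseteq> arcs_ends D"
  unfolding EP_def EQ_def using vpath_arcs_subset[OF vp(1)] vpath_arcs_subset[OF vp(2)] by blast

lemma ray_arcs_in_range: "EP \<union> EQ \<subseteq> range r \<times> range r"
  unfolding range_r using EP_mem EQ_mem by fast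

definition R where "R = thin_subgraph D (range r) (EP \<union> EQ)"

text \<open>The ray's edge at step \<open>k\<close>, oriented as it is in the digraph; it is mapped
  by \<open>chosen_arc\<close> to the enumeration of arcs that \<open>underlying_ray\<close> asks
  for.\<close>

definition edge where
  "edge k = (if (r k, r (Suc k)) \<in> EP then (r k, r (Suc k)) else (r (Suc k), r k))"

lemma edge_in: "edge k \<in> EP \<union> EQ"
  using ray_steps unfolding edge_def by auto

lemma edge_ends: "{fst (edge k), snd (edge k)} = {r k, r (Suc k)}"
  by (auto simp: edge_def)

lemma range_edge: "range edge = EP \<union> EQ"
proof (intro equalityI subsetI)
  fix e assume e: "e \<in> EP \<union> EQ"
  obtain x y where xy: "e = (x, y)"
    by (cases e)
  show "e \<in> range edge"
  proof (cases "e \<in> EP")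
    case True
    then obtain k where "e = (r k, r (Suc k))"
      using ray_steps by blast
    then show ?thesis
      using True by (auto simp: edge_def intro!: image_eqI[of _ _ k])
  next
    case False
    then have EQ: "(x, y) \<in> EQ"
      using e xy by auto
    then obtain k where k: "(y, x) = (r k, r (Suc k))"
      using ray_steps by blast
    have "(y, x) \<notin> EP"
      using EP_EQ_same_edge[OF _ EQ] by auto
    then show ?thesis
      using k xy by (auto simp: edge_def intro!: image_eqI[of _ _ k])
  qed
qed (use edge_in in blast)

lemma inj_edge: "inj edge"
proof (rule injI)
  fix j k assume "edge j = edge k"
  then have "{r j, r (Suc j)} = {r k, r (Suc k)}"
    using edge_ends by metis
  then show "j = k"
    using inj_r by (auto simp: doubleton_eq_iff inj_eq)
qed

lemma in_degree_2: "{x \<in> verts R. in_degree R x = 2} = range w"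
  using end_mem(2) unfolding R_def in_degree_thin_subgraph[OF ray_arcs_in_D] card_preds
  by (auto simp: range_r)

lemma ray: "alternating_ray R r"
  unfolding alternating_ray_def underlying_ray_def
proof (intro conjI)
  show "wf_digraph R"
    unfolding R_def by (rule wf_thin_subgraph[OF ray_arcs_in_D ray_arcs_in_range])
  have inj: "inj_on (chosen_arc D) (EP \<union> EQ)"
    by (rule inj_on_inverseI[of _ "arc_to_ends D"]) (use ray_arcs_in_D chosen_arc(2) in blast)
  have "range (chosen_arc D \<circ> edge) = chosen_arc D ` (EP \<union> EQ)"
    by (simp only: image_comp[symmetric] range_edge)
  then have "bij_betw (chosen_arc D \<circ> edge) UNIV (arcs R)"
    using inj inj_edge range_edge comp_inj_on[of edge UNIV "chosen_arc D"]
    by (simp add: bij_betw_def R_def)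
  moreover have "{tail R ((chosen_arc D \<circ> edge) n), head R ((chosen_arc D \<circ> edge) n)} = {r n, r (Suc n)}" for n
  proof -
    have "edge n \<in> arcs_ends D"
      using edge_in ray_arcs_in_D by blast
    then show ?thesis
      using chosen_arc_ends[of "fst (edge n)" "snd (edge n)" D] edge_ends[of n] by (simp add: R_def)
  qed
  ultimately show "\<exists>a. bij_betw a UNIV (arcs R) \<and> (\<forall>n. {tail R (a n), head R (a n)} = {r n, r (Suc n)})"
    by blast
  show "infinite {x \<in> verts R. in_degree R x = 2}"
    unfolding in_degree_2 using inj_w by (simp add: finite_image_iff)
qed (simp_all add: inj_r R_def)

section \<open>The whole comb as a subdigraph\<close>

definition links where "links = insert l\<^sub>0 (range l)"
definition VC where "VC = range r \<union> (\<Union>x\<in>links. set x)"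
definition EC where "EC = EP \<union> EQ \<union> (\<Union>x\<in>links. set (vwalk_arcs x))"
definition C where "C = thin_subgraph D VC EC"

lemma EC: "EC \<subseteq> arcs_ends D" "EC \<subseteq> VC \<times> VC"
proof -
  show "EC \<subseteq> arcs_ends D"
    using ray_arcs_in_D vpath_arcs_subset[OF vp(3)] vpath_arcs_subset[OF first(1)]
    unfolding EC_def links_def by blast
  have "set (vwalk_arcs x) \<subseteq> set x \<times> set x" for x :: "'v list"
    by (cases x) (auto dest: vwalk_arcsD)
  then show "EC \<subseteq> VC \<times> VC"
    using ray_arcs_in_range unfolding EC_def VC_def by fast
qed

lemma VC: "VC \<subseteq> verts D"
  unfolding VC_def links_def range_r
  using vpath_subset_verts[OF vp(1)] vpath_subset_verts[OF vp(2)] vpath_subset_verts[OF vp(3)]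
    vpath_subset_verts[OF first(1)] by blast

lemma linkage_C: "linkage C (last ` links) links"
  unfolding linkage_def
proof (intro conjI ballI)
  fix x assume x: "x \<in> links"
  have "arcs_ends C = EC"
    unfolding C_def by (rule arcs_ends_thin_subgraph[OF EC(1)])
  then have "set x \<subseteq> verts C" "set (vwalk_arcs x) \<subseteq> arcs_ends C"
    using x by (auto simp: C_def VC_def EC_def)
  moreover have "vpath x D"
    using x vp(3) first(1) by (auto simp: links_def)
  ultimately show "vpath x C"
    by (simp add: vpath_def vwalk_def)
  show "last x \<in> last ` links"
    using x by simp
next
  \<comment> \<open>The only vertex of the teeth that \<open>l\<^sub>0\<close> can meet is
    \<open>v 0\<close>, in the tooth of index 0, and it is not on \<open>l 0\<close>.\<close>
  have "disjnt (set l\<^sub>0) (set (l n))" for n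
    using first_inter[of _ n] v_not_mem(2)[of 0] unfolding disjnt_iff U_def by (metis UnI2)
  moreover have "disjnt (set (l m)) (set (l n))" if "l m \<noteq> l n" for m n
    using that l_l by (auto simp: disjnt_iff)
  ultimately show "pairwise (\<lambda>x y. disjnt (set x) (set y)) links"
    unfolding links_def pairwise_insert by (auto simp: pairwise_def disjnt_sym)
qed

lemma contains_comb: "contains_alternating_comb D B"
proof -
  have wf: "wf_digraph D"
    using dim by (simp add: dimaze_def)
  have XB: "last ` links \<subseteq> B"
    using first(3) ends(6) by (auto simp: links_def)
  have ends_C: "arcs_ends C = EC"
    unfolding C_def by (rule arcs_ends_thin_subgraph[OF EC(1)])
  \<comment> \<open>An arc of \<open>C\<close> leaving \<open>x\<close> would be an arc of the
    dimaze leaving an exit.\<close>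
  have "out_arcs C x = {}" if "x \<in> B" for x
  proof -
    have "(x, head C a) \<in> arcs_ends D" if "a \<in> out_arcs C x" for a
      using that EC(1) ends_C unfolding arcs_ends_def arc_to_ends_def out_arcs_def by blast
    then show ?thesis
      using exit_no_arc[OF dim \<open>x \<in> B\<close>] by blast
  qed
  moreover have "last ` links \<subseteq> verts C"
    using linkage_C last_in_set vpath_not_Nil vpath_subset_verts unfolding linkage_def by blast
  ultimately have "dimaze C (last ` links)"
    using XB wf_thin_subgraph[OF EC] unfolding dimaze_def C_def by blast
  moreover have "nomulti_digraph C"
    unfolding C_def by (rule nomulti_thin_subgraph[OF EC])
  moreover have "subgraph R C"
    unfolding R_def C_def
    by (rule thin_subgraph_mono[OF EC]) (use ray_arcs_in_range in \<open>auto simp: EC_def VC_def\<close>)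
  moreover have "hd ` links = insert (r 0) {x \<in> verts R. in_degree R x = 2}"
    unfolding in_degree_2 links_def by (simp add: first(2) ends(1,5) r_0 image_image)
  moreover have "set x \<inter> verts R = {hd x}" if x: "x \<in> links" for x
  proof (cases "x = l\<^sub>0")
    case True
    have "set l\<^sub>0 \<inter> range r \<subseteq> {v 0}"
      unfolding range_r using first_inter by (fastforce simp: U_def)
    moreover have "v 0 \<in> set l\<^sub>0"
      using first(2) ends(1)[of 0] hd_in_set[OF nonempty(4)] by metis
    moreover have "v 0 \<in> range r"
      using end_mem(1) unfolding range_r by blast
    ultimately show ?thesis
      using True by (auto simp: R_def first(2) ends(1))
  next
    case False
    then obtain n where n: "x = l n"
      using x by (auto simp: links_def)
    have "set (l n) \<inter> range r = {w n}"
    proof (intro equalityI subsetI)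
      fix y assume "y \<in> set (l n) \<inter> range r"
      then obtain m where "y \<in> set (l n)" "y \<in> set (p m) \<or> y \<in> set (q m)"
        unfolding range_r by auto
      then show "y \<in> {w n}"
        using p_l[of y m n] q_l[of y m n] by auto
    next
      fix y assume "y \<in> {w n}"
      then show "y \<in> set (l n) \<inter> range r"
        unfolding range_r using end_mem(2,5)[of n] by auto
    qed
    then show ?thesis
      by (simp add: R_def n ends(5))
  qed
  moreover have "arcs_ends R = EP \<union> EQ"
    unfolding R_def by (rule arcs_ends_thin_subgraph[OF ray_arcs_in_D])
  ultimately have "alternating_comb C (last ` links)"
    unfolding alternating_comb_def
    using ray linkage_C ends_C
    by (intro conjI exI[of _ R] exI[of _ r] exI[of _ links]) (auto simp: C_def R_def VC_def EC_def)
  moreover have "subgraph C D"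
    unfolding C_def by (rule thin_subgraph_subgraph[OF wf EC VC])
  ultimately show ?thesis
    unfolding contains_alternating_comb_def using XB by blast
qed

end

section \<open>Choosing the teeth recursively\<close>

lemma finite_sets_force_comb:
  assumes dim: "dimaze D B" and ne: "verts D \<noteq> {}"
    and ind: "all_finite_independent (M_L D B)" and av: "all_finite_avoidable (M_L D B)"
  shows "contains_alternating_comb D B"
proof -
  obtain x where "x \<in> verts D"
    using ne by auto
  then have "linkable D B {x}"
    using ind by (auto simp: all_finite_independent_def M_L_def)
  then obtain P where P: "linkage D B P" "hd ` P = {x}"
    by (auto simp: linkable_def)
  then have "P \<noteq> {}"
    by auto
  then obtain y where y: "y \<in> B"
    using P(1) by (auto simp: linkage_def)
  \<comment> \<open>A single exit with an empty obstacle already suffices for the counting. The path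
    to \<open>y\<close> obtained next is the link from the first vertex of the ray.\<close>
  have y_reached: "infinite {x. reaches D {} x y}"
    using infinitely_many_reach_exit[OF dim av, of "{y}" "{}"] y by auto
  obtain l\<^sub>0 where l0: "vpath l\<^sub>0 D" "last l\<^sub>0 = y"
    and inf: "infinite {z \<in> B. reaches D (set l\<^sub>0 - {hd l\<^sub>0}) (hd l\<^sub>0) z}"
    using path_to_exit_from_far_vertex[OF dim ind y y_reached finite.emptyI] by auto
  define U where "U p q l = set p \<union> set q \<union> set l" for p q l :: "'a list"
  \<comment> \<open>In a state, \<open>F\<close> collects the vertices of \<open>l\<^sub>0\<close>
    and of all earlier teeth except the current start \<open>hd p\<close>. The clause for
    \<open>n = 0\<close> ties the first tooth to \<open>l\<^sub>0\<close>.\<close>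
  define St where "St n s \<longleftrightarrow> (case s of (F, p, q, l) \<Rightarrow>
      finite F \<and> tooth D B p q l \<and> U p q l \<inter> F = {} \<and>
      infinite {z \<in> B. reaches D (F \<union> (U p q l - {hd q})) (hd q) z} \<and>
      (n = 0 \<longrightarrow> F = set l\<^sub>0 - {hd l\<^sub>0} \<and> hd p = hd l\<^sub>0))" for n :: nat and s
  define Nx where "Nx s s' \<longleftrightarrow> (case s of (F, p, q, l) \<Rightarrow> case s' of (F', p', q', l') \<Rightarrow>
      F' = F \<union> (U p q l - {hd q}) \<and> hd p' = hd q)" for s s' :: "'a set \<times> 'a list \<times> 'a list \<times> 'a list"
  have "\<exists>s. St 0 s"
  proof -
    have "finite (set l\<^sub>0 - {hd l\<^sub>0})"
      by simp
    from tooth_extension[OF dim ind av this inf, folded U_def] obtain p q l where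
      "tooth D B p q l" "hd p = hd l\<^sub>0" "U p q l \<inter> (set l\<^sub>0 - {hd l\<^sub>0}) = {}"
      "infinite {z \<in> B. reaches D (set l\<^sub>0 - {hd l\<^sub>0} \<union> (U p q l - {hd q})) (hd q) z}"
      by (elim exE conjE)
    then have "St 0 (set l\<^sub>0 - {hd l\<^sub>0}, p, q, l)"
      by (simp add: St_def)
    then show ?thesis
      by (rule exI)
  qed
  moreover have "\<exists>s'. St (Suc n) s' \<and> Nx s s'" if s: "St n s" for n s
  proof -
    obtain F p q l where sF: "s = (F, p, q, l)"
      by (cases s)
    define F' where "F' = F \<union> (U p q l - {hd q})"
    have "finite F'" "infinite {z \<in> B. reaches D F' (hd q) z}"
      using s by (auto simp: sF St_def F'_def U_def)
    from tooth_extension[OF dim ind av this, folded U_def] obtain p' q' l' where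
      "tooth D B p' q' l'" "hd p' = hd q" "U p' q' l' \<inter> F' = {}"
      "infinite {z \<in> B. reaches D (F' \<union> (U p' q' l' - {hd q'})) (hd q') z}"
      by (elim exE conjE)
    then have "St (Suc n) (F', p', q', l')" "Nx s (F', p', q', l')"
      using \<open>finite F'\<close> by (simp_all add: St_def Nx_def sF F'_def)
    then show ?thesis
      by (intro exI conjI)
  qed
  ultimately have "\<exists>f. \<forall>n. St n (f n) \<and> Nx (f n) (f (Suc n))"
    by (rule dependent_nat_choice)
  then obtain f where "\<forall>n. St n (f n) \<and> Nx (f n) (f (Suc n))"
    by (elim exE)
  then have f: "St n (f n)" "Nx (f n) (f (Suc n))" for n
    by simp_all
  define F p q l where "F n = fst (f n)" and "p n = fst (snd (f n))"
    and "q n = fst (snd (snd (f n)))" and "l n = snd (snd (snd (f n)))" for n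
  have f_eq: "f n = (F n, p n, q n, l n)" for n
    by (simp add: F_def p_def q_def l_def)
  have st: "tooth D B (p n) (q n) (l n)" "U (p n) (q n) (l n) \<inter> F n = {}" for n
    using f(1)[of n] by (simp_all add: St_def f_eq)
  have st0: "F 0 = set l\<^sub>0 - {hd l\<^sub>0}" "hd (p 0) = hd l\<^sub>0"
    using f(1)[of 0] by (simp_all add: St_def f_eq)
  have nx: "F (Suc n) = F n \<union> (U (p n) (q n) (l n) - {hd (q n)})" "hd (p (Suc n)) = hd (q n)" for n
    using f(2)[of n] by (simp_all add: Nx_def f_eq)
  \<comment> \<open>Forbidden sets only grow, so avoiding the current one separates a tooth from all
    earlier teeth and from \<open>l\<^sub>0\<close>.\<close>
  have mono: "F m \<subseteq> F n" if "m \<le> n" for m n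
    using that by (induction rule: dec_induct) (auto simp: nx)
  have "teeth D B p q l l\<^sub>0"
  proof
    fix m n :: nat assume "m < n"
    then have "U (p m) (q m) (l m) - {hd (q m)} \<subseteq> F n"
      using mono[of "Suc m" n] nx(1)[of m] by auto
    then show "(set (p m) \<union> set (q m) \<union> set (l m) - {hd (q m)}) \<inter>
        (set (p n) \<union> set (q n) \<union> set (l n)) = {}"
      using st(2)[of n] unfolding U_def by blast
  next
    fix n
    show "set l\<^sub>0 \<inter> (set (p n) \<union> set (q n) \<union> set (l n)) \<subseteq> {hd (p 0)}"
    proof -
      have "set l\<^sub>0 - {hd (p 0)} \<subseteq> F n"
        using mono[of 0 n] by (simp add: st0)
      then show ?thesis
        using st(2)[of n] by (auto simp: U_def)
    qed
    show "tooth D B (p n) (q n) (l n)" "hd (q n) = hd (p (Suc n))"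
      by (simp_all only: st nx)
    show "hd l\<^sub>0 = hd (p 0)" "last l\<^sub>0 \<in> B"
      using y by (simp_all only: st0 l0)
  qed (fact dim l0(1))+
  then show ?thesis
    by (rule teeth.contains_comb)
qed

theorem corollary3p6:
  fixes D' :: "('v, 'e) pre_digraph" and B\<^sub>0' :: "'v set"
  assumes "dimaze D' B\<^sub>0'"
    and "matroid (M_L D' B\<^sub>0')"
    and "set_system_iso (M_L D' B\<^sub>0') (M_L omega_tree omega_tree_exits)"
  shows "contains_alternating_comb D' B\<^sub>0'"
proof (rule finite_sets_force_comb[OF assms(1)])
  have sub: "snd (M_L D' B\<^sub>0') \<subseteq> Pow (fst (M_L D' B\<^sub>0'))"
    by (auto simp: M_L_def)
  show "all_finite_independent (M_L D' B\<^sub>0')" "all_finite_avoidable (M_L D' B\<^sub>0')"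
    using set_system_iso_transfer[OF assms(3) sub omega_tree_all_finite_independent
      omega_tree_all_finite_avoidable] .
  show "verts D' \<noteq> {}"
    using assms(3) by (auto simp: set_system_iso_def M_L_def bij_betw_def)
qed

end
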